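(* Let $P^*$ be a probability distribution, let $P_i=(1-\varepsilon_i)P^*+\varepsilon_iQ_i$ for $i\in N=\{1,\dots,n\}$, with $\varepsilon_i\in[0,1)$ and $Q_i$ probability distributions, let $\omega=(\omega_1,\dots,\omega_n)$ be a probability vector, and let $P_\omega=\sum_{i\in N}\omega_iP_i$, $\varepsilon_\omega=\sum_{i\in N}\omega_i\varepsilon_i$ and $Q_\omega=\frac1{\varepsilon_\omega}\sum_{i\in N}\omega_i\varepsilon_iQ_i$. For a probability distribution $P$ put $\Upsilon(P)=-d(P,P^* )$ and $\hat\Upsilon(P)=-d(P,P_\omega)$, where $d$ is the MMD. Then for every probability distribution $P$, $$|\Upsilon(P)-\hat\Upsilon(P)|\le \varepsilon_\omega\, d(Q_\omega,P^* ).$$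
   Context: All distributions are probability measures on a common measurable space $\mathcal X$. $k$ is a fixed measurable (real, symmetric, positive semidefinite) kernel on $\mathcal X$ bounded above by a constant $K$: $k(x,x')\le K$ for all $x,x'$; $\mathcal F$ is the unit ball of its reproducing kernel Hilbert space. The maximum mean discrepancy (MMD) is $d(P,P')=\sup_{f\in\mathcal F}\big(\mathbb E_{X\sim P}f(X)-\mathbb E_{W\sim P'}f(W)\big)$. If $\varepsilon_\omega=0$, $Q_\omega$ is taken to be an arbitrary probability distribution, so that $\varepsilon_\omega d(Q_\omega,P^* )=0$. *)

theory Defs
  imports "HOL-Probability.Probability"
begin

definition psd_kernel_on :: "'a set \<Rightarrow> ('a \<Rightarrow> 'a \<Rightarrow> real) \<Rightarrow> bool" where
  "psd_kernel_on S k \<longleftrightarrow>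
     (\<forall>x\<in>S. \<forall>y\<in>S. k x y = k y x) \<and>
     (\<forall>T c. finite T \<and> T \<subseteq> S \<longrightarrow> 0 \<le> (\<Sum>x\<in>T. \<Sum>y\<in>T. c x * c y * k x y))"

(* Real functions on a set S are represented by functions on the whole type that vanish
   outside S. *)

definition kernel_section :: "'a set \<Rightarrow> ('a \<Rightarrow> 'a \<Rightarrow> real) \<Rightarrow> 'a \<Rightarrow> ('a \<Rightarrow> real)" where
  "kernel_section S k x = (\<lambda>y. if y \<in> S then k x y else 0)"

(* rkhs S k H ip: the function space H with inner product ip is a real Hilbert space of
   functions on S that contains all sections k(x, -) and has the reproducing property.
   For a positive semidefinite kernel k on S there is exactly one such H, and ip is unique
   on H (Moore-Aronszajn); the values of ip outside H are irrelevant. *)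

locale rkhs =
  fixes S :: "'a set"
    and k :: "'a \<Rightarrow> 'a \<Rightarrow> real"
    and H :: "('a \<Rightarrow> real) set"
    and ip :: "('a \<Rightarrow> real) \<Rightarrow> ('a \<Rightarrow> real) \<Rightarrow> real"
  assumes supp: "\<And>f x. f \<in> H \<Longrightarrow> x \<notin> S \<Longrightarrow> f x = 0"
    and zero_closed: "(\<lambda>x. 0) \<in> H"
    and add_closed: "\<And>f g. f \<in> H \<Longrightarrow> g \<in> H \<Longrightarrow> (\<lambda>x. f x + g x) \<in> H"
    and scale_closed: "\<And>c f. f \<in> H \<Longrightarrow> (\<lambda>x. c * f x) \<in> H"
    and ip_commute: "\<And>f g. f \<in> H \<Longrightarrow> g \<in> H \<Longrightarrow> ip f g = ip g f"
    and ip_add_left: "\<And>f g h. f \<in> H \<Longrightarrow> g \<in> H \<Longrightarrow> h \<in> H \<Longrightarrow>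
                        ip (\<lambda>x. f x + g x) h = ip f h + ip g h"
    and ip_scale_left: "\<And>c f g. f \<in> H \<Longrightarrow> g \<in> H \<Longrightarrow> ip (\<lambda>x. c * f x) g = c * ip f g"
    and ip_nonneg: "\<And>f. f \<in> H \<Longrightarrow> 0 \<le> ip f f"
    and ip_definite: "\<And>f. f \<in> H \<Longrightarrow> ip f f = 0 \<Longrightarrow> f = (\<lambda>x. 0)"
    and complete: "\<And>F :: nat \<Rightarrow> 'a \<Rightarrow> real.
          (\<And>n. F n \<in> H) \<Longrightarrow>
          (\<And>e. e > 0 \<Longrightarrow> \<exists>N. \<forall>m\<ge>N. \<forall>n\<ge>N.
             sqrt (ip (\<lambda>x. F m x - F n x) (\<lambda>x. F m x - F n x)) < e) \<Longrightarrow>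
          \<exists>g\<in>H. (\<lambda>n. sqrt (ip (\<lambda>x. F n x - g x) (\<lambda>x. F n x - g x))) \<longlonglongrightarrow> 0"
    and section_in: "\<And>x. x \<in> S \<Longrightarrow> kernel_section S k x \<in> H"
    and reproducing: "\<And>f x. f \<in> H \<Longrightarrow> x \<in> S \<Longrightarrow> ip f (kernel_section S k x) = f x"

definition ip_unit_ball ::
    "('a \<Rightarrow> real) set \<Rightarrow> (('a \<Rightarrow> real) \<Rightarrow> ('a \<Rightarrow> real) \<Rightarrow> real) \<Rightarrow> ('a \<Rightarrow> real) set" where
  "ip_unit_ball H ip = {f \<in> H. sqrt (ip f f) \<le> 1}"

(* A real supremum: meaningful only where the differences of expectations are bounded
   over F, as for the unit ball of the RKHS of a bounded kernel. *)
definition mmd :: "('a \<Rightarrow> real) set \<Rightarrow> 'a measure \<Rightarrow> 'a measure \<Rightarrow> real" where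
  "mmd F P P' = (SUP f\<in>F. (\<integral>x. f x \<partial>P) - (\<integral>x. f x \<partial>P'))"

definition contaminate :: "'a measure \<Rightarrow> real \<Rightarrow> 'a measure \<Rightarrow> 'a measure \<Rightarrow> 'a measure" where
  "contaminate M e P Q = measure_of (space M) (sets M)
     (\<lambda>A. ennreal (1 - e) * emeasure P A + ennreal e * emeasure Q A)"

definition weighted_sum_measure ::
    "'a measure \<Rightarrow> 'i set \<Rightarrow> ('i \<Rightarrow> real) \<Rightarrow> ('i \<Rightarrow> 'a measure) \<Rightarrow> 'a measure" where
  "weighted_sum_measure M I w P = measure_of (space M) (sets M)
     (\<lambda>A. \<Sum>i\<in>I. ennreal (w i) * emeasure (P i) A)"

lemma emeasure_contaminate:
  assumes "sets P = sets M" "sets Q = sets M" "A \<in> sets M"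
  shows "emeasure (contaminate M e P Q) A
           = ennreal (1 - e) * emeasure P A + ennreal e * emeasure Q A"
proof (rule emeasure_measure_of[OF contaminate_def])
  show "countably_additive (sets (contaminate M e P Q))
      (\<lambda>A. ennreal (1 - e) * emeasure P A + ennreal e * emeasure Q A)"
    using assms
    by (auto simp: countably_additive_def contaminate_def suminf_add[symmetric] suminf_emeasure)
qed (use assms in \<open>auto simp: positive_def contaminate_def dest: sets.sets_into_space\<close>)

lemma emeasure_weighted_sum_measure:
  assumes "\<And>i. i \<in> I \<Longrightarrow> sets (P i) = sets M" "A \<in> sets M"
  shows "emeasure (weighted_sum_measure M I w P) A
           = (\<Sum>i\<in>I. ennreal (w i) * emeasure (P i) A)"
proof (rule emeasure_measure_of[OF weighted_sum_measure_def])
  show "countably_additive (sets (weighted_sum_measure M I w P))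
      (\<lambda>A. \<Sum>i\<in>I. ennreal (w i) * emeasure (P i) A)"
    using assms
    by (auto simp: countably_additive_def weighted_sum_measure_def suminf_sum suminf_emeasure
        intro!: sum.cong)
qed (use assms in \<open>auto simp: positive_def weighted_sum_measure_def dest: sets.sets_into_space\<close>)

end

(* Every f in the unit ball is bounded, so expectations of f are affine in the measure and
   E_R f - E_Pw f = (E_R f - E_Pstar f) + ew (E_Pstar f - E_Qw f). Taking suprema over the
   unit ball, which is closed under negation, gives the two halves of the bound.
   A non-measurable f has integral 0 under every measure on M, so affinity holds for it too. *)
theory Submission
  imports Defs
begin

section \<open>Integrals against finite combinations of measures\<close>

text \<open>Both sides are compatible with scaling, sums and increasing limits in \<open>g\<close>,
  so induction over measurable functions reduces the claim to indicators, where it is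
  \<open>emeasure_N\<close>. The weights are arbitrary elements of \<open>ennreal\<close>;
  normalisation enters only in the real-valued version.\<close>

lemma nn_integral_finite_combination:
  assumes sets_N: "sets N = sets M"
    and sets_P: "\<And>i. i \<in> I \<Longrightarrow> sets (P i) = sets M"
    and emeasure_N: "\<And>A. A \<in> sets M \<Longrightarrow> emeasure N A = (\<Sum>i\<in>I. w i * emeasure (P i) A)"
    and g: "g \<in> borel_measurable M"
  shows "(\<integral>\<^sup>+x. g x \<partial>N) = (\<Sum>i\<in>I. w i * (\<integral>\<^sup>+x. g x \<partial>P i))"
  using g
proof (induction rule: borel_measurable_induct)
  case (cong f g)
  have "(\<integral>\<^sup>+x. f x \<partial>N) = (\<integral>\<^sup>+x. g x \<partial>N)"
    using cong(3) sets_eq_imp_space_eq[OF sets_N] by (intro nn_integral_cong) auto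
  moreover have "(\<integral>\<^sup>+x. f x \<partial>P i) = (\<integral>\<^sup>+x. g x \<partial>P i)" if "i \<in> I" for i
    using cong(3) sets_eq_imp_space_eq[OF sets_P[OF that]] by (intro nn_integral_cong) auto
  ultimately show ?case
    using cong(4) by simp
next
  case (set A)
  then show ?case
    using sets_N sets_P emeasure_N by simp
next
  case (mult u c)
  have "u \<in> borel_measurable N" "\<And>i. i \<in> I \<Longrightarrow> u \<in> borel_measurable (P i)"
    using mult(2) sets_N sets_P by (auto cong: measurable_cong_sets)
  then show ?case
    using mult(4) by (simp add: nn_integral_cmult sum_distrib_left mult.left_commute)
next
  case (add u v)
  have "u \<in> borel_measurable N" "\<And>i. i \<in> I \<Longrightarrow> u \<in> borel_measurable (P i)"
    "v \<in> borel_measurable N" "\<And>i. i \<in> I \<Longrightarrow> v \<in> borel_measurable (P i)"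
    using add.hyps sets_N sets_P by (auto cong: measurable_cong_sets)
  then show ?case
    using add.IH by (simp add: nn_integral_add distrib_left sum.distrib)
next
  case (seq U)
  have meas: "U j \<in> borel_measurable N" "\<And>i. i \<in> I \<Longrightarrow> U j \<in> borel_measurable (P i)" for j
    using seq.hyps sets_N sets_P by (auto cong: measurable_cong_sets)
  have seq_mono: "incseq U"
    using seq.hyps by simp
  have "(\<integral>\<^sup>+x. (SUP j. U j x) \<partial>N) = (SUP j. \<integral>\<^sup>+x. U j x \<partial>N)"
    using seq_mono meas by (intro nn_integral_monotone_convergence_SUP) auto
  also have "\<dots> = (SUP j. \<Sum>i\<in>I. w i * (\<integral>\<^sup>+x. U j x \<partial>P i))"
    using seq.IH by simp
  \<comment> \<open>Supremum and finite sum may be exchanged because every summand increases with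
    \<open>j\<close>.\<close>
  also have "\<dots> = (\<Sum>i\<in>I. SUP j. w i * (\<integral>\<^sup>+x. U j x \<partial>P i))"
  proof (rule ennreal_SUP_sum)
    show "incseq (\<lambda>j. w i * (\<integral>\<^sup>+x. U j x \<partial>P i))" for i
      using seq_mono by (intro monoI mult_left_mono nn_integral_mono)
        (auto simp: mono_def le_fun_def)
  qed
  also have "\<dots> = (\<Sum>i\<in>I. w i * (\<integral>\<^sup>+x. (SUP j. U j x) \<partial>P i))"
    using seq_mono meas
    by (intro sum.cong refl)
      (simp add: nn_integral_monotone_convergence_SUP SUP_mult_left_ennreal)
  finally show ?case
    by (simp add: image_comp SUP_apply)
qed

text \<open>Adding \<open>C\<close> makes the integrand nonnegative, so the previous lemma applies.
  All measures involved have mass 1 and the weights sum to 1, so the shift contributes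
  \<open>C\<close> on both sides and cancels.\<close>

lemma integral_finite_combination:
  fixes f :: "'a \<Rightarrow> real"
  assumes sets_N: "sets N = sets M"
    and prob: "\<And>i. i \<in> I \<Longrightarrow> P i \<in> space (prob_algebra M)"
    and w: "\<And>i. i \<in> I \<Longrightarrow> 0 \<le> w i" "sum w I = 1"
    and emeasure_N: "\<And>A. A \<in> sets M \<Longrightarrow>
      emeasure N A = (\<Sum>i\<in>I. ennreal (w i) * emeasure (P i) A)"
    and bound: "\<And>x. \<bar>f x\<bar> \<le> C"
  shows "N \<in> space (prob_algebra M)"
    and "(\<integral>x. f x \<partial>N) = (\<Sum>i\<in>I. w i * (\<integral>x. f x \<partial>P i))"
proof -
  have sets_P: "sets (P i) = sets M" and prob_P: "prob_space (P i)" if "i \<in> I" for i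
    using prob[OF that] by (auto simp: space_prob_algebra)
  have "emeasure N (space N) = (\<Sum>i\<in>I. ennreal (w i) * emeasure (P i) (space (P i)))"
    using emeasure_N[of "space M"] sets_eq_imp_space_eq[OF sets_N]
      sets_eq_imp_space_eq[OF sets_P] by simp
  also have "\<dots> = (\<Sum>i\<in>I. ennreal (w i))"
    using prob_space.emeasure_space_1[OF prob_P] by simp
  also have "\<dots> = 1"
    using w by (simp add: sum_ennreal)
  finally have N: "prob_space N"
    by (rule prob_spaceI)
  then show "N \<in> space (prob_algebra M)"
    using sets_N by (simp add: space_prob_algebra)
  show "(\<integral>x. f x \<partial>N) = (\<Sum>i\<in>I. w i * (\<integral>x. f x \<partial>P i))"
  proof (cases "f \<in> borel_measurable M")
    case False
    \<comment> \<open>Measurability depends only on the sigma-algebra, so \<open>f\<close> fails to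
      be integrable under \<open>N\<close> and every \<open>P i\<close> alike, and all these
      integrals take the default value 0.\<close>
    then have "(\<integral>x. f x \<partial>L) = 0" if "sets L = sets M" for L
      using that
      by (intro not_integrable_integral_eq) (auto cong: measurable_cong_sets)
    then show ?thesis
      using sets_N sets_P by simp
  next
    case True
    define g where "g = (\<lambda>x. f x + C)"
    have g: "g \<in> borel_measurable M" "0 \<le> g x" for x
      using True bound[of x] by (auto simp: g_def)
    have int: "integrable L f" "ennreal (\<integral>x. g x \<partial>L) = (\<integral>\<^sup>+x. ennreal (g x) \<partial>L)"
      "(\<integral>x. g x \<partial>L) = (\<integral>x. f x \<partial>L) + C" "0 \<le> (\<integral>x. g x \<partial>L)"
      if L: "prob_space L" "sets L = sets M" for L
    proof -
      interpret prob_space L by fact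
      have "f \<in> borel_measurable L"
        using True L(2) by (auto cong: measurable_cong_sets)
      then show f: "integrable L f"
        using bound by (intro integrable_const_bound[where B = C]) auto
      then have "integrable L g"
        by (simp add: g_def)
      then show "ennreal (\<integral>x. g x \<partial>L) = (\<integral>\<^sup>+x. ennreal (g x) \<partial>L)"
        using g(2) by (simp add: nn_integral_eq_integral)
      show "(\<integral>x. g x \<partial>L) = (\<integral>x. f x \<partial>L) + C"
        using f by (simp add: g_def prob_space)
      show "0 \<le> (\<integral>x. g x \<partial>L)"
        using g(2) by simp
    qed
    have "ennreal (\<integral>x. g x \<partial>N) = (\<Sum>i\<in>I. ennreal (w i) * (\<integral>\<^sup>+x. ennreal (g x) \<partial>P i))"
      unfolding int(2)[OF N sets_N] using sets_N sets_P emeasure_N g(1)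
      by (intro nn_integral_finite_combination[of N M]) auto
    also have "\<dots> = (\<Sum>i\<in>I. ennreal (w i * (\<integral>x. g x \<partial>P i)))"
      using int(2)[OF prob_P sets_P] int(4)[OF prob_P sets_P] w(1)
      by (intro sum.cong refl) (simp add: ennreal_mult)
    also have "\<dots> = ennreal (\<Sum>i\<in>I. w i * (\<integral>x. g x \<partial>P i))"
      using int(4)[OF prob_P sets_P] w(1) by (intro sum_ennreal) simp
    \<comment> \<open>Cancelling \<open>ennreal\<close> requires both real numbers to be
      nonnegative, which is the purpose of the shift.\<close>
    finally have "(\<integral>x. g x \<partial>N) = (\<Sum>i\<in>I. w i * (\<integral>x. g x \<partial>P i))"
      using int(4)[OF prob_P sets_P] int(4)[OF N sets_N] w(1)
      by (subst (asm) ennreal_inj) (auto intro!: sum_nonneg)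
    also have "\<dots> = (\<Sum>i\<in>I. w i * (\<integral>x. f x \<partial>P i)) + C"
      using int(3)[OF prob_P sets_P] w(2)
      by (simp add: distrib_left sum.distrib sum_distrib_right[symmetric])
    finally show ?thesis
      using int(3)[OF N sets_N] by simp
  qed
qed

section \<open>Suprema over uniformly bounded function classes\<close>

lemma (in prob_space) abs_integral_le_bound:
  fixes f :: "'a \<Rightarrow> real"
  assumes "\<And>x. \<bar>f x\<bar> \<le> C"
  shows "\<bar>\<integral>x. f x \<partial>M\<bar> \<le> C"
proof (cases "integrable M f")
  case True
  have "\<bar>\<integral>x. f x \<partial>M\<bar> \<le> (\<integral>x. \<bar>f x\<bar> \<partial>M)"
    by (rule integral_abs_bound)
  also have "\<dots> \<le> C"
    using True assms by (intro integral_le_const) auto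
  finally show ?thesis .
next
  case False
  then show ?thesis
    \<comment> \<open>The integral is 0 by default; evaluating the bound at any one point gives
      \<open>0 \<le> C\<close>.\<close>
    using assms[of undefined] by (simp add: not_integrable_integral_eq)
qed

text \<open>A real supremum dominates its members only if the set is bounded above; here each
  difference of expectations is at most \<open>C + C\<close>.\<close>

lemma mmd_upper:
  assumes "prob_space P" "prob_space P'"
    and bound: "\<And>f x. f \<in> F \<Longrightarrow> \<bar>f x\<bar> \<le> C"
    and "f \<in> F"
  shows "(\<integral>x. f x \<partial>P) - (\<integral>x. f x \<partial>P') \<le> mmd F P P'"
  unfolding mmd_def
proof (rule cSUP_upper)
  show "bdd_above ((\<lambda>f. (\<integral>x. f x \<partial>P) - (\<integral>x. f x \<partial>P')) ` F)"
  proof (rule bdd_aboveI2)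
    fix f assume "f \<in> F"
    then show "(\<integral>x. f x \<partial>P) - (\<integral>x. f x \<partial>P') \<le> C + C"
      using prob_space.abs_integral_le_bound[OF assms(1), of f C]
        prob_space.abs_integral_le_bound[OF assms(2), of f C] bound by (smt (verit))
  qed
qed fact

text \<open>The supremum argument, separated from kernels: of \<open>P'\<close> it uses only that it
  integrates members of \<open>F\<close> like the mixture of \<open>P\<close> and \<open>Q\<close>.
  Nonemptiness of \<open>F\<close> lets a bound on all members pass to the real supremum.\<close>

lemma mmd_mixture_diff:
  assumes "prob_space R" "prob_space P" "prob_space P'" "prob_space Q" "0 \<le> e"
    and F: "F \<noteq> {}" "\<And>f. f \<in> F \<Longrightarrow> (\<lambda>x. - f x) \<in> F"
    and bound: "\<And>f x. f \<in> F \<Longrightarrow> \<bar>f x\<bar> \<le> C"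
    and mix: "\<And>f. f \<in> F \<Longrightarrow>
      (\<integral>x. f x \<partial>P') = (1 - e) * (\<integral>x. f x \<partial>P) + e * (\<integral>x. f x \<partial>Q)"
  shows "\<bar>mmd F R P - mmd F R P'\<bar> \<le> e * mmd F Q P"
proof -
  have QP: "e * ((\<integral>x. f x \<partial>Q) - (\<integral>x. f x \<partial>P)) \<le> e * mmd F Q P" if "f \<in> F" for f
    using mmd_upper[of Q P F C f] assms(4,2) bound that \<open>0 \<le> e\<close> by (intro mult_left_mono) auto
  have "mmd F R P \<le> mmd F R P' + e * mmd F Q P"
    unfolding mmd_def[of F R P]
  proof (rule cSUP_least[OF F(1)])
    fix f assume f: "f \<in> F"
    show "(\<integral>x. f x \<partial>R) - (\<integral>x. f x \<partial>P) \<le> mmd F R P' + e * mmd F Q P"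
      \<comment> \<open>By \<open>mix\<close>, replacing \<open>P\<close> by \<open>P'\<close>
        changes the expectation of \<open>f\<close> by \<open>e\<close> times its difference between
        \<open>Q\<close> and \<open>P\<close>.\<close>
      using mmd_upper[OF assms(1,3) _ f, of C] bound QP[OF f] mix[OF f] by (simp add: algebra_simps)
  qed
  moreover have "mmd F R P' \<le> mmd F R P + e * mmd F Q P"
    unfolding mmd_def[of F R P']
  proof (rule cSUP_least[OF F(1)])
    fix f assume f: "f \<in> F"
    show "(\<integral>x. f x \<partial>R) - (\<integral>x. f x \<partial>P') \<le> mmd F R P + e * mmd F Q P"
      \<comment> \<open>The correction now has the opposite sign, so \<open>QP\<close> is applied to
        the negated function.\<close>
      using mmd_upper[OF assms(1,2) _ f, of C] bound QP[OF F(2)[OF f]] mix[OF f]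
      by (simp add: algebra_simps)
  qed
  ultimately show ?thesis
    by simp
qed

section \<open>The unit ball of the reproducing kernel Hilbert space\<close>

context rkhs
begin

lemma zero_in_unit_ball: "(\<lambda>x. 0) \<in> ip_unit_ball H ip"
  using ip_scale_left[OF zero_closed zero_closed, of 0] zero_closed
  by (simp add: ip_unit_ball_def)

lemma uminus_in_unit_ball:
  assumes "f \<in> ip_unit_ball H ip"
  shows "(\<lambda>x. - f x) \<in> ip_unit_ball H ip"
proof -
  have f: "f \<in> H" and m: "(\<lambda>x. - f x) \<in> H"
    using assms scale_closed[of f "-1"] by (auto simp: ip_unit_ball_def)
  have "ip (\<lambda>x. - f x) (\<lambda>x. - f x) = - ip f (\<lambda>x. - f x)"
    using ip_scale_left[OF f m, of "-1"] by simp
  also have "\<dots> = ip f f"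
    using ip_commute[OF f m] ip_scale_left[OF f f, of "-1"] by simp
  finally show ?thesis
    using assms m by (simp add: ip_unit_ball_def)
qed

(* Expanding 0 \<le> ip (f + k_x) (f + k_x) is enough; Cauchy-Schwarz would give sqrt K. *)
lemma unit_ball_ge:
  assumes f: "f \<in> ip_unit_ball H ip" and K: "\<And>x y. x \<in> S \<Longrightarrow> y \<in> S \<Longrightarrow> k x y \<le> K"
  shows "- (1 + \<bar>K\<bar>) \<le> f x"
proof (cases "x \<in> S")
  case False
  then show ?thesis
    using f supp[of f x] by (simp add: ip_unit_ball_def)
next
  case True
  let ?s = "kernel_section S k x"
  have fH: "f \<in> H" "ip f f \<le> 1" and s: "?s \<in> H"
    using f section_in[OF True] by (auto simp: ip_unit_ball_def)
  have fs: "(\<lambda>y. f y + ?s y) \<in> H"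
    using add_closed fH(1) s .
  have "ip (\<lambda>y. f y + ?s y) (\<lambda>y. f y + ?s y) =
      ip f (\<lambda>y. f y + ?s y) + ip ?s (\<lambda>y. f y + ?s y)"
    using ip_add_left[OF fH(1) s fs] .
  also have "\<dots> = ip f f + 2 * ip f ?s + ip ?s ?s"
    using ip_commute[OF fH(1) fs] ip_commute[OF s fs] ip_add_left[OF fH(1) s fH(1)]
      ip_add_left[OF fH(1) s s] ip_commute[OF fH(1) s] by simp
  also have "\<dots> = ip f f + 2 * f x + k x x"
    using reproducing[OF fH(1) True] reproducing[OF s True] True
    by (simp add: kernel_section_def)
  \<comment> \<open>With \<open>ip f f \<le> 1\<close> and \<open>k x x \<le> K\<close> this yields
    \<open>- (1 + K) / 2 \<le> f x\<close>. The weaker constant \<open>1 + \<bar>K\<bar>\<close> is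
    nonnegative for any \<open>K\<close>, so it also serves outside \<open>S\<close>, where
    \<open>f\<close> vanishes.\<close>
  finally show ?thesis
    using ip_nonneg[OF fs] fH(2) K[OF True True] by linarith
qed

text \<open>The upper bound is the lower bound for the negated function, which lies in the ball
  too.\<close>

lemma unit_ball_bounded:
  assumes "f \<in> ip_unit_ball H ip" "\<And>x y. x \<in> S \<Longrightarrow> y \<in> S \<Longrightarrow> k x y \<le> K"
  shows "\<bar>f x\<bar> \<le> 1 + \<bar>K\<bar>"
  using unit_ball_ge[OF assms, of x] unit_ball_ge[OF uminus_in_unit_ball[OF assms(1)] assms(2), of x]
  by (simp add: abs_le_iff)

end

section \<open>The contamination model\<close>

lemma integral_contaminate:
  fixes f :: "'a \<Rightarrow> real"
  assumes P: "P \<in> space (prob_algebra M)" and Q: "Q \<in> space (prob_algebra M)"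
    and e: "0 \<le> e" "e \<le> 1" and bound: "\<And>x. \<bar>f x\<bar> \<le> C"
  shows "contaminate M e P Q \<in> space (prob_algebra M)"
    and "(\<integral>x. f x \<partial>contaminate M e P Q) = (1 - e) * (\<integral>x. f x \<partial>P) + e * (\<integral>x. f x \<partial>Q)"
proof -
  \<comment> \<open>Contamination is a convex combination of two measures, here indexed by
    \<open>bool\<close>.\<close>
  let ?w = "\<lambda>b. if b then 1 - e else e" and ?P = "\<lambda>b. if b then P else Q"
  have sets: "sets (contaminate M e P Q) = sets M"
    by (simp add: contaminate_def)
  have em: "emeasure (contaminate M e P Q) A = (\<Sum>b\<in>UNIV. ennreal (?w b) * emeasure (?P b) A)"
    if "A \<in> sets M" for A
    using that P Q by (simp add: emeasure_contaminate space_prob_algebra UNIV_bool add.commute)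
  have *: "?P b \<in> space (prob_algebra M)" "0 \<le> ?w b" "sum ?w UNIV = 1" for b
    using P Q e by (auto simp: UNIV_bool)
  show "contaminate M e P Q \<in> space (prob_algebra M)"
    using integral_finite_combination(1)[OF sets *(1) *(2) *(3) em bound] .
  show "(\<integral>x. f x \<partial>contaminate M e P Q) = (1 - e) * (\<integral>x. f x \<partial>P) + e * (\<integral>x. f x \<partial>Q)"
    using integral_finite_combination(2)[OF sets *(1) *(2) *(3) em bound]
    by (simp add: UNIV_bool)
qed

theorem proposition2:
  fixes M :: "'a measure"
    and k :: "'a \<Rightarrow> 'a \<Rightarrow> real" and K :: real
    and H :: "('a \<Rightarrow> real) set"
    and ip :: "('a \<Rightarrow> real) \<Rightarrow> ('a \<Rightarrow> real) \<Rightarrow> real"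
    and n :: nat and \<epsilon> \<omega> :: "nat \<Rightarrow> real" and \<epsilon>\<^sub>\<omega> :: real
    and Pstar P\<^sub>\<omega> Q\<^sub>\<omega> :: "'a measure" and P Q :: "nat \<Rightarrow> 'a measure"
    and d :: "'a measure \<Rightarrow> 'a measure \<Rightarrow> real"
    and \<Upsilon> \<Upsilon>hat :: "'a measure \<Rightarrow> real"
  assumes k_measurable: "(\<lambda>(x, y). k x y) \<in> borel_measurable (M \<Otimes>\<^sub>M M)"
    and k_psd: "psd_kernel_on (space M) k"
    and k_le: "\<And>x y. x \<in> space M \<Longrightarrow> y \<in> space M \<Longrightarrow> k x y \<le> K"
    and H_rkhs: "rkhs (space M) k H ip"
    and d_def: "d = mmd (ip_unit_ball H ip)"
    and Pstar: "Pstar \<in> space (prob_algebra M)"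
    and Q: "\<And>i. i \<in> {1..n} \<Longrightarrow> Q i \<in> space (prob_algebra M)"
    and \<epsilon>_range: "\<And>i. i \<in> {1..n} \<Longrightarrow> \<epsilon> i \<in> {0..<1}"
    and P_eq: "\<And>i. i \<in> {1..n} \<Longrightarrow> P i = contaminate M (\<epsilon> i) Pstar (Q i)"
    and \<omega>_nonneg: "\<And>i. i \<in> {1..n} \<Longrightarrow> 0 \<le> \<omega> i"
    and \<omega>_sum: "(\<Sum>i=1..n. \<omega> i) = 1"
    and P\<omega>_eq: "P\<^sub>\<omega> = weighted_sum_measure M {1..n} \<omega> P"
    and \<epsilon>\<omega>_eq: "\<epsilon>\<^sub>\<omega> = (\<Sum>i=1..n. \<omega> i * \<epsilon> i)"
    and Q\<omega>_eq: "\<epsilon>\<^sub>\<omega> \<noteq> 0 \<Longrightarrow>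
          Q\<^sub>\<omega> = scale_measure (ennreal (1 / \<epsilon>\<^sub>\<omega>))
                 (weighted_sum_measure M {1..n} (\<lambda>i. \<omega> i * \<epsilon> i) Q)"
    and Q\<omega>_arbitrary: "\<epsilon>\<^sub>\<omega> = 0 \<Longrightarrow> Q\<^sub>\<omega> \<in> space (prob_algebra M)"
    and \<Upsilon>_eq: "\<And>R. R \<in> space (prob_algebra M) \<Longrightarrow> \<Upsilon> R = - d R Pstar"
    and \<Upsilon>hat_eq: "\<And>R. R \<in> space (prob_algebra M) \<Longrightarrow> \<Upsilon>hat R = - d R P\<^sub>\<omega>"
  shows "\<forall>R \<in> space (prob_algebra M). \<bar>\<Upsilon> R - \<Upsilon>hat R\<bar> \<le> \<epsilon>\<^sub>\<omega> * d Q\<^sub>\<omega> Pstar"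
proof -
  let ?F = "ip_unit_ball H ip" and ?C = "1 + \<bar>K\<bar>"
  interpret rkhs "space M" k H ip
    by (rule H_rkhs)
  have bound: "\<bar>f x\<bar> \<le> ?C" if "f \<in> ?F" for f x
    using unit_ball_bounded[OF that k_le] .
  have \<epsilon>: "0 \<le> \<epsilon> i" "\<epsilon> i \<le> 1" if "i \<in> {1..n}" for i
    using \<epsilon>_range[OF that] by auto
  \<comment> \<open>The lemmas on combinations carry a bounded integrand even where they only assert
    that a measure is a probability; the zero function fills that slot.\<close>
  note zero_bound = bound[OF zero_in_unit_ball]
  have P: "P i \<in> space (prob_algebra M)" if "i \<in> {1..n}" for i
    using integral_contaminate(1)[OF Pstar Q \<epsilon> zero_bound] P_eq that by metis
  have sets_P: "sets (P i) = sets M" and sets_Q: "sets (Q i) = sets M" if "i \<in> {1..n}" for i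
    using P[OF that] Q[OF that] by (auto simp: space_prob_algebra)
  have sets_P\<omega>: "sets P\<^sub>\<omega> = sets M"
    by (simp add: P\<omega>_eq weighted_sum_measure_def)
  have em_P\<omega>: "emeasure P\<^sub>\<omega> A = (\<Sum>i=1..n. ennreal (\<omega> i) * emeasure (P i) A)"
    if "A \<in> sets M" for A
    unfolding P\<omega>_eq using sets_P that by (intro emeasure_weighted_sum_measure)
  note P\<omega> = integral_finite_combination[OF sets_P\<omega> P \<omega>_nonneg \<omega>_sum em_P\<omega>]
  have \<epsilon>\<omega>_nonneg: "0 \<le> \<epsilon>\<^sub>\<omega>"
    unfolding \<epsilon>\<omega>_eq using \<omega>_nonneg \<epsilon> by (intro sum_nonneg) simp
  \<comment> \<open>The identity is kept multiplied by \<open>\<epsilon>\<^sub>\<omega>\<close>, so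
    that it also makes sense for an arbitrary \<open>Q\<^sub>\<omega>\<close> in the degenerate
    case.\<close>
  have Q\<omega>: "Q\<^sub>\<omega> \<in> space (prob_algebra M) \<and>
      \<epsilon>\<^sub>\<omega> * (\<integral>x. f x \<partial>Q\<^sub>\<omega>) = (\<Sum>i=1..n. \<omega> i * \<epsilon> i * (\<integral>x. f x \<partial>Q i))" if f: "f \<in> ?F" for f
  proof (cases "\<epsilon>\<^sub>\<omega> = 0")
    case True
    \<comment> \<open>A vanishing sum of nonnegative terms has only zero terms, so both sides of the
      identity are 0.\<close>
    then have "\<omega> i * \<epsilon> i = 0" if "i \<in> {1..n}" for i
      using that \<omega>_nonneg \<epsilon> unfolding \<epsilon>\<omega>_eq
      by (subst (asm) sum_nonneg_eq_0_iff) auto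
    then have "(\<Sum>i=1..n. \<omega> i * \<epsilon> i * (\<integral>x. f x \<partial>Q i)) = 0"
      by (intro sum.neutral ballI) (simp only: mult_zero_left)
    then show ?thesis
      using True Q\<omega>_arbitrary by (simp only: mult_zero_left)
  next
    case False
    \<comment> \<open>Moving the scaling factor into the weights turns
      \<open>Q\<^sub>\<omega>\<close> into a convex combination of the \<open>Q i\<close>.\<close>
    let ?w = "\<lambda>i. \<omega> i * \<epsilon> i / \<epsilon>\<^sub>\<omega>"
    have sets: "sets Q\<^sub>\<omega> = sets M"
      using Q\<omega>_eq[OF False] by (simp add: weighted_sum_measure_def)
    have w: "0 \<le> ?w i" if "i \<in> {1..n}" for i
      using \<omega>_nonneg[OF that] \<epsilon>[OF that] \<epsilon>\<omega>_nonneg by simp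
    have w_sum: "(\<Sum>i=1..n. ?w i) = 1"
      using False by (simp add: \<epsilon>\<omega>_eq sum_divide_distrib[symmetric])
    have em: "emeasure Q\<^sub>\<omega> A = (\<Sum>i=1..n. ennreal (?w i) * emeasure (Q i) A)"
      if A: "A \<in> sets M" for A
    proof -
      have "emeasure Q\<^sub>\<omega> A =
          ennreal (1 / \<epsilon>\<^sub>\<omega>) * (\<Sum>i=1..n. ennreal (\<omega> i * \<epsilon> i) * emeasure (Q i) A)"
        unfolding Q\<omega>_eq[OF False] emeasure_scale_measure
        by (rule arg_cong[OF emeasure_weighted_sum_measure[OF sets_Q A]])
      also have "\<dots> = (\<Sum>i=1..n. ennreal (?w i) * emeasure (Q i) A)"
        unfolding sum_distrib_left
      proof (rule sum.cong[OF refl])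
        fix i assume "i \<in> {1..n}"
        then have "ennreal (?w i) = ennreal (1 / \<epsilon>\<^sub>\<omega>) * ennreal (\<omega> i * \<epsilon> i)"
          using \<epsilon>\<omega>_nonneg \<omega>_nonneg \<epsilon> by (subst ennreal_mult[symmetric]) auto
        then show "ennreal (1 / \<epsilon>\<^sub>\<omega>) * (ennreal (\<omega> i * \<epsilon> i) * emeasure (Q i) A) =
            ennreal (?w i) * emeasure (Q i) A"
          by (simp add: mult.assoc)
      qed
      finally show ?thesis .
    qed
    note * = integral_finite_combination[OF sets Q w w_sum em bound[OF f]]
    have "(\<integral>x. f x \<partial>Q\<^sub>\<omega>) = (\<Sum>i=1..n. ?w i * (\<integral>x. f x \<partial>Q i))"
      by (rule *(2))
    then show ?thesis
      using *(1) False by (simp add: sum_distrib_left)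
  qed
  \<comment> \<open>On the unit ball, the average of the contaminated measures acts as a single
    contamination of \<open>Pstar\<close> by \<open>Q\<^sub>\<omega>\<close> at level
    \<open>\<epsilon>\<^sub>\<omega>\<close>.\<close>
  have mix: "(\<integral>x. f x \<partial>P\<^sub>\<omega>) = (1 - \<epsilon>\<^sub>\<omega>) * (\<integral>x. f x \<partial>Pstar) + \<epsilon>\<^sub>\<omega> * (\<integral>x. f x \<partial>Q\<^sub>\<omega>)"
    if f: "f \<in> ?F" for f
  proof -
    have P_int: "(\<integral>x. f x \<partial>P i) = (1 - \<epsilon> i) * (\<integral>x. f x \<partial>Pstar) + \<epsilon> i * (\<integral>x. f x \<partial>Q i)"
      if "i \<in> {1..n}" for i
      unfolding P_eq[OF that]
      by (rule integral_contaminate(2)[OF Pstar Q[OF that] \<epsilon>[OF that] bound[OF f]])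
    have "(\<integral>x. f x \<partial>P\<^sub>\<omega>) = (\<Sum>i=1..n. \<omega> i * (\<integral>x. f x \<partial>P i))"
      using P\<omega>(2)[OF _ _ _ bound[OF f]] by simp
    also have "\<dots> = (\<Sum>i=1..n. \<omega> i * (\<integral>x. f x \<partial>Pstar) - \<omega> i * \<epsilon> i * (\<integral>x. f x \<partial>Pstar)
        + \<omega> i * \<epsilon> i * (\<integral>x. f x \<partial>Q i))"
      by (intro sum.cong refl) (simp add: P_int algebra_simps)
    also have "\<dots> = (1 - \<epsilon>\<^sub>\<omega>) * (\<integral>x. f x \<partial>Pstar) + \<epsilon>\<^sub>\<omega> * (\<integral>x. f x \<partial>Q\<^sub>\<omega>)"
      using conjunct2[OF Q\<omega>[OF f]] \<omega>_sum
      by (simp add: sum.distrib sum_subtractf sum_distrib_right[symmetric] \<epsilon>\<omega>_eq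
          left_diff_distrib)
    finally show ?thesis .
  qed
  have prob: "prob_space Pstar" "prob_space P\<^sub>\<omega>" "prob_space Q\<^sub>\<omega>"
    using Pstar P\<omega>(1)[OF _ _ _ zero_bound] Q\<omega>[OF zero_in_unit_ball]
    by (auto simp: space_prob_algebra)
  show ?thesis
  proof
    fix R assume R: "R \<in> space (prob_algebra M)"
    then have "prob_space R"
      by (simp add: space_prob_algebra)
    then have "\<bar>mmd ?F R Pstar - mmd ?F R P\<^sub>\<omega>\<bar> \<le> \<epsilon>\<^sub>\<omega> * mmd ?F Q\<^sub>\<omega> Pstar"
      using prob \<epsilon>\<omega>_nonneg zero_in_unit_ball uminus_in_unit_ball bound mix
      by (intro mmd_mixture_diff[where C = ?C]) auto
    then show "\<bar>\<Upsilon> R - \<Upsilon>hat R\<bar> \<le> \<epsilon>\<^sub>\<omega> * d Q\<^sub>\<omega> Pstar"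
      using R by (simp add: \<Upsilon>_eq \<Upsilon>hat_eq d_def abs_minus_commute)
  qed
qed

end
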